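(* Let $p>0$ and, for each integer $n>2$, let $A_n$ be the area of the regular $n$-gon of perimeter $p$, i.e. $A_n=\frac{p^2}{4n\tan(\pi/n)}$. Then $A_{n+1}>A_n$ for all integers $n>2$.
   Context: The perimeter $p$ is fixed and the same for all $n$; each side of the regular $n$-gon has length $p/n$. *)

theory Defs
  imports "HOL-Analysis.Analysis"
begin

text \<open>
  Only the values \<open>V 0, \<dots>, V (n - 1)\<close> of a vertex sequence \<open>V :: nat \<Rightarrow> real ^ 2\<close> are relevant.
  They are listed in counterclockwise order, equally spaced on a circle of positive radius
  with arbitrary centre and phase.
\<close>

definition regular_ngon :: "nat \<Rightarrow> (nat \<Rightarrow> real ^ 2) \<Rightarrow> bool" where
  "regular_ngon n V \<longleftrightarrow> n > 2 \<and>
     (\<exists>c r \<theta>. r > 0 \<and>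
        (\<forall>k<n. V k = c + r *\<^sub>R vector [cos (\<theta> + 2 * pi * real k / real n),
                                        sin (\<theta> + 2 * pi * real k / real n)]))"

definition ngon_perimeter :: "nat \<Rightarrow> (nat \<Rightarrow> real ^ 2) \<Rightarrow> real" where
  "ngon_perimeter n V = (\<Sum>k<n. dist (V k) (V (Suc k mod n)))"

text \<open>
  The convex hull is the region bounded by the polygon only for convex polygons with vertices
  listed in order, such as the regular ones above.
\<close>

definition convex_ngon_area :: "nat \<Rightarrow> (nat \<Rightarrow> real ^ 2) \<Rightarrow> real" where
  "convex_ngon_area n V = measure lebesgue (convex hull (V ` {..<n}))"

lemma dist_circle_points:
  fixes c :: "real ^ 2"
  assumes "r \<ge> 0"
  shows "dist (c + r *\<^sub>R vector [cos a, sin a]) (c + r *\<^sub>R vector [cos b, sin b])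
           = 2 * r * \<bar>sin ((b - a) / 2)\<bar>"
proof -
  have "(cos a - cos b)\<^sup>2 + (sin a - sin b)\<^sup>2 = 2 - 2 * cos (b - a)"
    using sin_cos_squared_add[of a] sin_cos_squared_add[of b]
    by (simp add: cos_diff power2_eq_square algebra_simps)
  also have "\<dots> = (2 * sin ((b - a) / 2))\<^sup>2"
  proof -
    have "cos (2 * ((b - a) / 2)) = 1 - 2 * (sin ((b - a) / 2))\<^sup>2"
      by (rule cos_double_sin)
    moreover have "2 * ((b - a) / 2) = b - a" by simp
    ultimately show ?thesis by (simp only: power_mult_distrib) simp
  qed
  finally have *: "(cos a - cos b)\<^sup>2 + (sin a - sin b)\<^sup>2 = (2 * sin ((b - a) / 2))\<^sup>2" .
  have "dist (c + r *\<^sub>R vector [cos a, sin a]) (c + r *\<^sub>R vector [cos b, sin b])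
          = sqrt ((r * cos a - r * cos b)\<^sup>2 + (r * sin a - r * sin b)\<^sup>2)"
    by (simp add: dist_vec_def L2_set_def sum_2 dist_real_def)
  also have "(r * cos a - r * cos b)\<^sup>2 + (r * sin a - r * sin b)\<^sup>2
               = r\<^sup>2 * ((cos a - cos b)\<^sup>2 + (sin a - sin b)\<^sup>2)"
    by (simp only: right_diff_distrib[symmetric] power_mult_distrib distrib_left)
  also have "\<dots> = (r * (2 * sin ((b - a) / 2)))\<^sup>2"
    by (simp only: * power_mult_distrib)
  finally show ?thesis
    using assms by (simp add: abs_mult)
qed

lemma regular_ngon_side:
  assumes "regular_ngon n V" "k < n"
  shows "dist (V k) (V (Suc k mod n)) = ngon_perimeter n V / real n"
proof -
  obtain c r \<theta> where n: "n > 2" and r: "r > 0" and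
    V: "\<And>k. k < n \<Longrightarrow> V k = c + r *\<^sub>R vector [cos (\<theta> + 2 * pi * real k / real n),
                                          sin (\<theta> + 2 * pi * real k / real n)]"
    using assms(1) unfolding regular_ngon_def by blast
  have side: "dist (V j) (V (Suc j mod n)) = 2 * r * \<bar>sin (pi / real n)\<bar>" if j: "j < n" for j
  proof (cases "Suc j = n")
    case False
    then have "Suc j < n" using j by simp
    have "(\<theta> + 2 * pi * real (Suc j) / real n - (\<theta> + 2 * pi * real j / real n)) / 2 = pi / real n"
      using n by (simp add: field_simps)
    then show ?thesis
      using V[OF j] V[OF \<open>Suc j < n\<close>] \<open>Suc j < n\<close> r
      by (simp only: dist_circle_points[OF less_imp_le] mod_less)
  next
    case True
    have eq: "(\<theta> + 2 * pi * real 0 / real n - (\<theta> + 2 * pi * real j / real n)) / 2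
            = pi / real n - pi"
      using n True[symmetric] by (simp add: field_simps)
    have 0: "0 < n" using n by simp
    have "\<bar>sin (pi / real n - pi)\<bar> = \<bar>sin (pi / real n)\<bar>"
      by (simp add: sin_diff)
    then show ?thesis
      unfolding True mod_self V[OF j] V[OF 0] dist_circle_points[OF less_imp_le[OF r]] eq
      by (simp only:)
  qed
  have "ngon_perimeter n V = real n * (2 * r * \<bar>sin (pi / real n)\<bar>)"
  proof -
    have "ngon_perimeter n V = (\<Sum>j<n. 2 * r * \<bar>sin (pi / real n)\<bar>)"
      unfolding ngon_perimeter_def by (rule sum.cong) (use side in auto)
    then show ?thesis by (simp only: sum_constant card_lessThan)
  qed
  then show ?thesis
    using side[OF assms(2)] n by simp
qed

lemma regular_ngon_exists:
  assumes "n > 2" "p > 0"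
  shows "\<exists>V. regular_ngon n V \<and> ngon_perimeter n V = p"
proof -
  define s where "s = sin (pi / real n)"
  have s: "s > 0"
    unfolding s_def using assms(1) by (intro sin_gt_zero) (auto simp: field_simps)
  define r where "r = p / (2 * real n * s)"
  have r: "r > 0" using assms s by (simp add: r_def)
  define V :: "nat \<Rightarrow> real ^ 2" where
    "V k = 0 + r *\<^sub>R vector [cos (0 + 2 * pi * real k / real n), sin (0 + 2 * pi * real k / real n)]" for k
  have reg: "regular_ngon n V"
    unfolding regular_ngon_def using assms(1) r V_def by blast
  have "(0 + 2 * pi * real 1 / real n - (0 + 2 * pi * real 0 / real n)) / 2 = pi / real n"
    by simp
  then have "dist (V 0) (V 1) = 2 * r * s"
    unfolding V_def dist_circle_points[OF less_imp_le[OF r]] using s by (simp add: s_def)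
  moreover have "dist (V 0) (V 1) = ngon_perimeter n V / real n"
    using regular_ngon_side[OF reg, of 0] assms(1) by simp
  ultimately have "ngon_perimeter n V = p"
    using assms s by (simp add: r_def field_simps)
  with reg show ?thesis by blast
qed

end

theory Submission
  imports Defs
begin

text \<open>
  The triangles spanned by the centre and the edges of a regular polygon tile it up to the
  negligible rays through the vertices, which gives the area.  With x = pi / n the area is
  p^2 / (4 pi) times x / tan x, and x / tan x is strictly decreasing on (0, pi / 2)
  because sin x cos x < x.
\<close>

section \<open>Unit vectors and polar coordinates in the plane\<close>

definition circ :: "real \<Rightarrow> real ^ 2" where
  "circ t = vector [cos t, sin t]"

lemma circ_nth [simp]: "circ t $ 1 = cos t" "circ t $ 2 = sin t"
  by (simp_all add: circ_def)

lemma inner_circ: "circ a \<bullet> circ b = cos (a - b)"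
  by (simp add: inner_vec_def sum_2 cos_diff)

lemma circ_neq_0 [simp]: "circ t \<noteq> 0"
  using inner_circ[of t t] by auto

lemma circ_add_2pi [simp]: "circ (t + 2 * pi) = circ t"
  by (simp add: circ_def)

lemma circ_eq_iff: "circ a = circ b \<longleftrightarrow> (\<exists>k::int. a = b + 2 * pi * of_int k)"
proof -
  have "circ a = circ b \<longleftrightarrow> sin a = sin b \<and> cos a = cos b"
    by (auto simp: vec_eq_iff forall_2)
  then show ?thesis
    by (simp add: sin_cos_eq_iff algebra_simps)
qed

text \<open>The start \<open>m\<close> of the window of angles is left free: below, one window
  starts at a vertex of the polygon and another is centred at the bisector of a triangle.\<close>

lemma polar_exists:
  fixes x :: "real ^ 2"
  obtains t where "m \<le> t" "t < m + 2 * pi" "x = norm x *\<^sub>R circ t"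
proof -
  obtain s where s: "x = norm x *\<^sub>R circ s"
  proof (cases "x = 0")
    case False
    have "(x $ 1)\<^sup>2 + (x $ 2)\<^sup>2 = (norm x)\<^sup>2"
      by (simp add: norm_vec_def L2_set_def sum_2)
    then have "(x $ 1 / norm x)\<^sup>2 + (x $ 2 / norm x)\<^sup>2 = 1"
      using False by (simp add: power_divide add_divide_distrib[symmetric])
    then obtain s where s: "x $ 1 / norm x = cos s" "x $ 2 / norm x = sin s"
      by (rule sincos_total_2pi)
    have "x = norm x *\<^sub>R circ s"
      unfolding vec_eq_iff forall_2 using False by (simp flip: s)
    then show ?thesis by (rule that)
  next
    case True
    then show ?thesis by (intro that[of 0]) simp
  qed
  \<comment> \<open>\<open>k\<close> counts the full turns by which \<open>s\<close> lies outside
    the window.\<close>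
  define k where "k = \<lfloor>(s - m) / (2 * pi)\<rfloor>"
  define t where "t = s - 2 * pi * of_int k"
  have "of_int k \<le> (s - m) / (2 * pi)" "(s - m) / (2 * pi) < of_int k + 1"
    unfolding k_def by linarith+
  then have "m \<le> t" "t < m + 2 * pi"
    by (simp_all add: t_def field_simps)
  moreover have st: "circ s = circ t"
    unfolding circ_eq_iff by (rule exI[of _ k]) (simp add: t_def)
  have "x = norm x *\<^sub>R circ t" using s unfolding st .
  ultimately show ?thesis by (rule that)
qed

section \<open>Triangles spanned by the centre and one edge\<close>

text \<open>For the polygon centred at 0, \<open>r\<close> is the circumradius, \<open>h\<close>
  half the central angle of an edge and \<open>m\<close> the direction of the bisector.\<close>

definition sector_triangle :: "real \<Rightarrow> real \<Rightarrow> real \<Rightarrow> (real ^ 2) set" where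
  "sector_triangle r h m = convex hull {0, r *\<^sub>R circ (m - h), r *\<^sub>R circ (m + h)}"

lemma lmeasurable_sector_triangle: "sector_triangle r h m \<in> lmeasurable"
  unfolding sector_triangle_def
  by (intro lmeasurable_compact finite_imp_compact_convex_hull) auto

lemma measure_sector_triangle:
  assumes "0 < h" "h < pi / 2"
  shows "measure lebesgue (sector_triangle r h m) = r\<^sup>2 * sin h * cos h"
proof -
  have "sin (m + h) * cos (m - h) - cos (m + h) * sin (m - h) = 2 * sin h * cos h"
    using sin_diff[of "m + h" "m - h"] sin_double[of h] by simp
  \<comment> \<open>This is the determinant whose absolute value \<open>content_triangle\<close>
    halves; the order of the vertices makes it nonpositive.\<close>
  then have *: "r * cos (m + h) * (r * sin (m - h)) - r * cos (m - h) * (r * sin (m + h))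
      = - (2 * (r\<^sup>2 * sin h * cos h))"
    by (simp add: power2_eq_square) algebra
  have "0 \<le> sin h" "0 \<le> cos h"
    using assms by (auto intro!: sin_ge_zero cos_ge_zero)
  then have "0 \<le> r\<^sup>2 * sin h * cos h"
    by simp
  moreover have "compact (sector_triangle r h m)"
    unfolding sector_triangle_def by (intro finite_imp_compact_convex_hull) auto
  then have "measure lebesgue (sector_triangle r h m) = measure lborel (sector_triangle r h m)"
    by (intro measure_completion) (auto intro: borel_compact)
  ultimately show ?thesis
    using content_triangle[of 0 "r *\<^sub>R circ (m - h)" "r *\<^sub>R circ (m + h)"]
    unfolding sector_triangle_def by (simp add: *)
qed

text \<open>Cramer's rule for the basis \<open>circ (m - h)\<close>, \<open>circ (m + h)\<close>:
  determinants of unit vectors are sines of angle differences. Multiplying by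
  \<open>sin (2 * h)\<close> avoids division.\<close>

lemma circ_combination:
  "sin (h - \<psi>) *\<^sub>R circ (m - h) + sin (h + \<psi>) *\<^sub>R circ (m + h) = sin (2 * h) *\<^sub>R circ (m + \<psi>)"
proof -
  \<comment> \<open>These are the angles left by the product-to-sum formulas, normalised so that
    equal terms on both sides cancel.\<close>
  have eqs: "h - \<psi> + (m - h) = m - \<psi>" "h - \<psi> - (m - h) = 2 * h - (m + \<psi>)"
    "h + \<psi> + (m + h) = 2 * h + (m + \<psi>)" "h + \<psi> - (m + h) = - (m - \<psi>)"
    by simp_all
  show ?thesis
    unfolding vec_eq_iff forall_2
    by (simp add: sin_times_cos sin_times_sin eqs del: minus_diff_eq)
      (simp add: sin_minus cos_minus add_divide_distrib diff_divide_distrib del: minus_diff_eq)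
qed

text \<open>The triangle is cut out of its sector by the line of the outer edge, at distance
  \<open>r * cos h\<close> from 0. The sector makes the coefficients of the two outer vertices
  nonnegative, and the half-plane bounds their sum by 1.\<close>

lemma polar_in_sector_triangle:
  assumes h: "0 < h" "h < pi / 2" and "r > 0" "\<rho> \<ge> 0" "\<bar>\<phi> - m\<bar> \<le> h"
    and le: "circ m \<bullet> (\<rho> *\<^sub>R circ \<phi>) \<le> r * cos h"
  shows "\<rho> *\<^sub>R circ \<phi> \<in> sector_triangle r h m"
proof -
  define \<psi> where "\<psi> = \<phi> - m"
  have pos: "0 < sin h" "0 < cos h"
    using h by (auto intro!: sin_gt_zero cos_gt_zero)
  have \<psi>: "0 \<le> sin (h - \<psi>)" "0 \<le> sin (h + \<psi>)"
    using assms h unfolding \<psi>_def by (intro sin_ge_zero; linarith)+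
  \<comment> \<open>\<open>D\<close> equals \<open>r * sin (2 * h)\<close>, the denominator
    prescribed by \<open>circ_combination\<close>.\<close>
  define D where "D = 2 * r * sin h * cos h"
  have D: "D > 0" using pos assms by (simp add: D_def)
  define v where "v = \<rho> * sin (h - \<psi>) / D"
  define w where "w = \<rho> * sin (h + \<psi>) / D"
  \<comment> \<open>The two sines add up to \<open>2 * sin h * cos \<psi>\<close>, so the sum is the
    projection onto the bisector divided by the distance of the edge.\<close>
  have "v + w = \<rho> * cos \<psi> / (r * cos h)"
    using pos \<open>r > 0\<close> by (simp add: v_def w_def D_def sin_add sin_diff field_simps)
  moreover have "\<rho> * cos \<psi> \<le> r * cos h"
    using le by (simp add: inner_circ \<psi>_def cos_diff mult.commute)
  ultimately have "v + w \<le> 1"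
    using pos \<open>r > 0\<close> by simp
  have vw: "0 \<le> v" "0 \<le> w"
    using \<psi> D \<open>\<rho> \<ge> 0\<close> by (simp_all add: v_def w_def)
  have "v * r = \<rho> / sin (2 * h) * sin (h - \<psi>)" "w * r = \<rho> / sin (2 * h) * sin (h + \<psi>)"
    using \<open>r > 0\<close> by (simp_all add: v_def w_def D_def sin_double)
  then have "v *\<^sub>R (r *\<^sub>R circ (m - h)) + w *\<^sub>R (r *\<^sub>R circ (m + h))
      = (\<rho> / sin (2 * h)) *\<^sub>R (sin (h - \<psi>) *\<^sub>R circ (m - h) + sin (h + \<psi>) *\<^sub>R circ (m + h))"
    by (simp add: scaleR_add_right)
  also have "\<dots> = (\<rho> / sin (2 * h)) *\<^sub>R (sin (2 * h) *\<^sub>R circ \<phi>)"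
    unfolding circ_combination by (simp add: \<psi>_def)
  also have "\<dots> = \<rho> *\<^sub>R circ \<phi>"
    using pos by (simp add: sin_double)
  finally have "\<rho> *\<^sub>R circ \<phi>
      = (1 - v - w) *\<^sub>R 0 + v *\<^sub>R (r *\<^sub>R circ (m - h)) + w *\<^sub>R (r *\<^sub>R circ (m + h))"
    by simp
  moreover have "0 \<le> 1 - v - w" "(1 - v - w) + v + w = 1"
    using \<open>v + w \<le> 1\<close> by simp_all
  ultimately show ?thesis
    unfolding sector_triangle_def convex_hull_3 using vw by blast
qed

text \<open>Inner products with the inward normals of the two bounding rays are nonnegative on the
  triangle; in polar form they say that \<open>sin (h - \<psi>)\<close> and
  \<open>sin (h + \<psi>)\<close> are nonnegative.\<close>

lemma sector_triangle_polar:
  assumes h: "0 < h" "h < pi / 2" and "r > 0" and x: "x \<in> sector_triangle r h m"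
  obtains \<phi> where "\<bar>\<phi> - m\<bar> \<le> h" "x = norm x *\<^sub>R circ \<phi>"
proof (cases "x = 0")
  case True
  then show ?thesis using that[of m] h by simp
next
  case False
  obtain v w where vw: "0 \<le> v" "0 \<le> w"
    and xe: "x = v *\<^sub>R (r *\<^sub>R circ (m - h)) + w *\<^sub>R (r *\<^sub>R circ (m + h))"
    using x unfolding sector_triangle_def convex_hull_3 by auto
  obtain \<phi> where \<phi>: "m - pi \<le> \<phi>" "\<phi> < m - pi + 2 * pi" and xp: "x = norm x *\<^sub>R circ \<phi>"
    by (rule polar_exists)
  define \<psi> where "\<psi> = \<phi> - m"
  have pos: "0 < sin h" "0 < cos h" and s2: "0 \<le> sin (2 * h)"
    using h by (auto intro!: sin_gt_zero cos_gt_zero sin_ge_zero)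
  \<comment> \<open>This normal is orthogonal to \<open>circ (m + h)\<close>, so only the
    \<open>v\<close> term survives.\<close>
  have "circ (m + h - pi / 2) \<bullet> x = v * r * sin (2 * h)"
    unfolding xe by (simp add: inner_add_right inner_circ cos_diff)
  moreover have "circ (m + h - pi / 2) \<bullet> x = norm x * sin (h - \<psi>)"
  proof -
    have "circ (m + h - pi / 2) \<bullet> x = norm x * cos ((h - \<psi>) - pi / 2)"
      by (subst xp) (simp add: inner_circ \<psi>_def algebra_simps)
    then show ?thesis by (simp add: cos_diff)
  qed
  ultimately have "0 \<le> norm x * sin (h - \<psi>)"
    using vw s2 \<open>r > 0\<close> by simp
  then have a: "0 \<le> sin (h - \<psi>)"
    using False by (simp add: zero_le_mult_iff)
  have "circ (m - h + pi / 2) \<bullet> x = w * r * sin (2 * h)"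
    unfolding xe by (simp add: inner_add_right inner_circ cos_diff cos_add)
  moreover have "circ (m - h + pi / 2) \<bullet> x = norm x * sin (h + \<psi>)"
  proof -
    have "circ (m - h + pi / 2) \<bullet> x = norm x * cos (pi / 2 - (h + \<psi>))"
      by (subst xp) (simp add: inner_circ \<psi>_def algebra_simps)
    then show ?thesis by (simp add: cos_diff)
  qed
  ultimately have "0 \<le> norm x * sin (h + \<psi>)"
    using vw s2 \<open>r > 0\<close> by simp
  then have b: "0 \<le> sin (h + \<psi>)"
    using False by (simp add: zero_le_mult_iff)
  \<comment> \<open>Half the sum of the two sines. It confines \<open>\<psi>\<close> to
    \<open>\<bar>\<psi>\<bar> \<le> pi / 2\<close>, which keeps \<open>h - \<psi>\<close> and
    \<open>h + \<psi>\<close> above \<open>- pi\<close>, where \<open>nonneg\<close>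
    applies.\<close>
  have "0 \<le> sin h * cos \<psi>"
    using a b by (simp add: sin_add sin_diff)
  then have c: "0 \<le> cos \<psi>"
    using pos by (simp add: zero_le_mult_iff)
  have \<psi>r: "-pi \<le> \<psi>" "\<psi> < pi" using \<phi> by (auto simp: \<psi>_def)
  have "\<bar>\<psi>\<bar> \<le> pi / 2"
  proof (rule ccontr)
    assume "\<not> \<bar>\<psi>\<bar> \<le> pi / 2"
    then have "cos \<bar>\<psi>\<bar> < cos (pi / 2)"
      using \<psi>r by (intro cos_monotone_0_pi) auto
    then show False using c by simp
  qed
  have nonneg: "0 \<le> t" if "0 \<le> sin t" "- pi < t" for t :: real
  proof (rule ccontr)
    assume "\<not> 0 \<le> t"
    then have "0 < sin (- t)" using that by (intro sin_gt_zero) auto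
    then show False using that by simp
  qed
  have "0 \<le> h - \<psi>" "0 \<le> h + \<psi>"
    using \<open>\<bar>\<psi>\<bar> \<le> pi / 2\<close> h by (intro nonneg[OF a] nonneg[OF b]; linarith)+
  then have "\<bar>\<phi> - m\<bar> \<le> h" by (simp add: \<psi>_def abs_le_iff)
  then show ?thesis using that xp by blast
qed

text \<open>The hypotheses on \<open>m\<close> and \<open>m'\<close> keep the bisectors
  \<open>2 * h\<close> apart modulo full turns, so the sectors share at most bounding rays, which
  lie on two lines through 0.\<close>

lemma negligible_sector_triangle_Int:
  assumes h: "0 < h" "h < pi / 2" and "r > 0"
    and m: "2 * h \<le> \<bar>m - m'\<bar>" "\<bar>m - m'\<bar> \<le> 2 * pi - 2 * h"
  shows "negligible (sector_triangle r h m \<inter> sector_triangle r h m')"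
proof (rule negligible_subset)
  \<comment> \<open>\<open>?L a\<close> is the line through 0 in direction
    \<open>circ a\<close>.\<close>
  let ?L = "\<lambda>a. {x. circ (a + pi / 2) \<bullet> x = 0}"
  show "negligible (?L (m - h) \<union> ?L (m + h))"
    by (intro negligible_Un negligible_hyperplane) auto
  show "sector_triangle r h m \<inter> sector_triangle r h m' \<subseteq> ?L (m - h) \<union> ?L (m + h)"
  proof
    fix x assume x: "x \<in> sector_triangle r h m \<inter> sector_triangle r h m'"
    show "x \<in> ?L (m - h) \<union> ?L (m + h)"
    proof (cases "x = 0")
      case False
      obtain \<phi> where \<phi>: "\<bar>\<phi> - m\<bar> \<le> h" "x = norm x *\<^sub>R circ \<phi>"
        using sector_triangle_polar[OF h \<open>r > 0\<close>] x by blast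
      obtain \<phi>' where \<phi>': "\<bar>\<phi>' - m'\<bar> \<le> h" "x = norm x *\<^sub>R circ \<phi>'"
        using sector_triangle_polar[OF h \<open>r > 0\<close>] x by blast
      have "circ \<phi> = circ \<phi>'"
        using \<phi>(2) \<phi>'(2) False by (metis scaleR_cancel_left norm_eq_zero)
      then obtain k :: int where k: "\<phi> = \<phi>' + 2 * pi * of_int k"
        unfolding circ_eq_iff by blast
      \<comment> \<open>Each angle is within \<open>h\<close> of its bisector and the bisectors
        differ by at most \<open>2 * pi - 2 * h\<close>, so at most one full turn separates the
        angles.\<close>
      have "\<bar>2 * pi * of_int k\<bar> \<le> 2 * pi"
        using \<phi>(1) \<phi>'(1) m k by linarith
      then have "\<bar>of_int k :: real\<bar> \<le> 1"
        by (simp add: abs_mult)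
      then have "k = 0 \<or> k = 1 \<or> k = -1" by linarith
      \<comment> \<open>In each case the bounds can only hold with equality, which forces
        \<open>\<phi>\<close> to an end of its interval.\<close>
      then have "\<phi> = m - h \<or> \<phi> = m + h"
      proof (elim disjE)
        assume "k = 0"
        then show ?thesis using k \<phi>(1) \<phi>'(1) m by simp linarith
      next
        assume "k = 1"
        then show ?thesis using k \<phi>(1) \<phi>'(1) m by simp linarith
      next
        assume "k = -1"
        then show ?thesis using k \<phi>(1) \<phi>'(1) m by simp linarith
      qed
      moreover have "circ (\<phi> + pi / 2) \<bullet> x = 0"
        by (subst \<phi>(2)) (simp add: inner_circ)
      ultimately show ?thesis by auto
    qed simp
  qed
qed

section \<open>Decomposition of the polygon into triangles\<close>

text \<open>Multiplied by \<open>2 * sin h\<close>, each term is a difference of unit vectors half a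
  step to either side, turned back by a right angle. The sum telescopes, and its ends differ by a
  full turn.\<close>

lemma sum_circ_equally_spaced:
  assumes "n > 1"
  shows "(\<Sum>k<n. circ (\<theta> + 2 * pi * real k / real n)) = 0"
proof -
  define h where "h = pi / real n"
  have nh: "2 * real n * h = 2 * pi" using assms by (simp add: h_def)
  have s: "0 < sin h"
    using assms unfolding h_def by (intro sin_gt_zero) (auto simp: field_simps)
  let ?g = "\<lambda>k. \<theta> + 2 * real k * h"
  have "(2 * sin h) *\<^sub>R (\<Sum>k<n. circ (?g k))
      = (\<Sum>k<n. circ (?g (Suc k) - h - pi / 2) - circ (?g k - h - pi / 2))"
    unfolding scaleR_sum_right
  proof (rule sum.cong[OF refl])
    fix k
    have eq: "?g (Suc k) - h - pi / 2 = ?g k + h - pi / 2"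
      by (simp add: algebra_simps)
    show "(2 * sin h) *\<^sub>R circ (?g k) = circ (?g (Suc k) - h - pi / 2) - circ (?g k - h - pi / 2)"
      unfolding eq by (simp add: vec_eq_iff forall_2 sin_diff cos_diff sin_add cos_add)
  qed
  also have "\<dots> = circ (?g n - h - pi / 2) - circ (?g 0 - h - pi / 2)"
    by (rule sum_lessThan_telescope)
  also have "?g n - h - pi / 2 = (?g 0 - h - pi / 2) + 2 * pi"
    using nh by simp
  also have "circ \<dots> - circ (?g 0 - h - pi / 2) = 0"
    unfolding circ_add_2pi by simp
  finally show ?thesis
    using s by (simp add: h_def mult_ac)
qed

text \<open>Cosine decreases on [0, pi] and is symmetric about pi. This will place all vertices on
  the inner side of each edge line.\<close>

lemma cos_le_cos_away:
  assumes "0 \<le> h" "h \<le> \<bar>t\<bar>" "\<bar>t\<bar> \<le> 2 * pi - h"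
  shows "cos t \<le> cos h"
proof (cases "\<bar>t\<bar> \<le> pi")
  case True
  then have "cos \<bar>t\<bar> \<le> cos h" using assms by (intro cos_monotone_0_pi_le) auto
  then show ?thesis by simp
next
  case False
  then have "cos (2 * pi - \<bar>t\<bar>) \<le> cos h" using assms by (intro cos_monotone_0_pi_le) auto
  then show ?thesis by (simp add: cos_diff)
qed

text \<open>A point of the hull lies in the sector given by its direction and on the inner side of
  that sector's edge line, hence in the triangle. Conversely, the corners of each triangle lie in
  the hull, the centre being the mean of the vertices.\<close>

lemma hull_eq_Union_sector_triangle:
  assumes n: "n > 2" and r: "r > 0"
  defines "h \<equiv> pi / real n"
  shows "convex hull ((\<lambda>k. r *\<^sub>R circ (\<theta> + 2 * real k * h)) ` {..<n})
    = (\<Union>k<n. sector_triangle r h (\<theta> + (2 * real k + 1) * h))"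
    (is "?P = (\<Union>k<n. ?T k)")
proof
  have h: "0 < h" "h < pi / 2" and nh: "real n * h = pi"
    using n by (auto simp: h_def field_simps)
  let ?w = "\<lambda>k. r *\<^sub>R circ (\<theta> + 2 * real k * h)"
  show "?P \<subseteq> (\<Union>k<n. ?T k)"
  proof
    fix x assume x: "x \<in> ?P"
    obtain \<phi> where \<phi>: "\<theta> \<le> \<phi>" "\<phi> < \<theta> + 2 * pi" and xp: "x = norm x *\<^sub>R circ \<phi>"
      by (rule polar_exists)
    \<comment> \<open>Sectors have width \<open>2 * h\<close> counted from \<open>\<theta>\<close>;
      \<open>k\<close> is the index of the one containing \<open>\<phi>\<close>.\<close>
    define k where "k = nat \<lfloor>(\<phi> - \<theta>) / (2 * h)\<rfloor>"
    have q0: "0 \<le> (\<phi> - \<theta>) / (2 * h)" using \<phi> h by simp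
    have "real k \<le> (\<phi> - \<theta>) / (2 * h)" "(\<phi> - \<theta>) / (2 * h) < real k + 1"
      using q0 unfolding k_def by (auto simp: of_nat_nat)
    then have k1: "2 * real k * h \<le> \<phi> - \<theta>" and k2: "\<phi> - \<theta> < 2 * (real k + 1) * h"
      using h by (simp_all add: field_simps)
    have "2 * real k * h < 2 * real n * h" using k1 \<phi> nh by linarith
    then have kn: "k < n" using h by simp
    let ?m = "\<theta> + (2 * real k + 1) * h"
    \<comment> \<open>The line through edge \<open>k\<close> supports the polygon; it suffices to
      check the vertices.\<close>
    have "?P \<subseteq> {y. circ ?m \<bullet> y \<le> r * cos h}"
    proof (rule hull_minimal)
      show "convex {y. circ ?m \<bullet> y \<le> r * cos h}" by (rule convex_halfspace_le)
      show "?w ` {..<n} \<subseteq> {y. circ ?m \<bullet> y \<le> r * cos h}"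
      proof clarsimp
        fix j assume j: "j < n"
        \<comment> \<open>Vertex \<open>j\<close> is \<open>d * h\<close> away from the bisector. As
          \<open>d\<close> is odd, it is nonzero, so the angle stays at least \<open>h\<close> away
          from 0 and from a full turn.\<close>
        define d :: int where "d = 2 * (int k - int j) + 1"
        have "1 \<le> \<bar>d\<bar>" "\<bar>d\<bar> \<le> 2 * int n - 1"
          using j kn unfolding d_def by presburger+
        then have "1 \<le> \<bar>real_of_int d\<bar>" "\<bar>real_of_int d\<bar> \<le> 2 * real n - 1"
          by linarith+
        then have "1 * h \<le> \<bar>real_of_int d\<bar> * h" "\<bar>real_of_int d\<bar> * h \<le> (2 * real n - 1) * h"
          using h by (intro mult_right_mono; simp)+
        then have "cos (real_of_int d * h) \<le> cos h"
          using h nh by (intro cos_le_cos_away) (auto simp: abs_mult left_diff_distrib)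
        moreover have "?m - (\<theta> + 2 * real j * h) = real_of_int d * h"
          by (simp add: d_def algebra_simps)
        ultimately show "r * (circ ?m \<bullet> circ (\<theta> + 2 * real j * h)) \<le> r * cos h"
          using r by (simp add: inner_circ)
      qed
    qed
    then have "circ ?m \<bullet> (norm x *\<^sub>R circ \<phi>) \<le> r * cos h"
      using x xp by auto
    moreover have "\<bar>\<phi> - ?m\<bar> \<le> h"
      using k1 k2 by (simp add: abs_le_iff algebra_simps)
    ultimately have "x \<in> ?T k"
      using polar_in_sector_triangle[OF h r norm_ge_zero] xp by metis
    then show "x \<in> (\<Union>k<n. ?T k)" using kn by blast
  qed
  have w: "?w k \<in> ?P" if "k < n" for k
    using that by (intro hull_inc) auto
  have "(\<Sum>k<n. (1 / real n) *\<^sub>R ?w k) \<in> ?P"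
    using n w by (intro convex_sum) auto
  moreover have "(\<Sum>k<n. (1 / real n) *\<^sub>R ?w k) = (r / real n) *\<^sub>R (\<Sum>k<n. circ (\<theta> + 2 * pi * real k / real n))"
    by (simp add: scaleR_sum_right h_def mult_ac)
  ultimately have zero: "0 \<in> ?P"
    using sum_circ_equally_spaced[of n \<theta>] n by simp
  \<comment> \<open>The last edge ends at index \<open>n\<close>, which is vertex 0 again.\<close>
  have wn: "?w n = ?w 0"
  proof -
    have "\<theta> + 2 * real n * h = \<theta> + 2 * pi" using nh by simp
    then show ?thesis by (simp only: circ_add_2pi) simp
  qed
  have "?T k \<subseteq> ?P" if "k < n" for k
  proof -
    have 1: "\<theta> + (2 * real k + 1) * h - h = \<theta> + 2 * real k * h"
      and 2: "\<theta> + (2 * real k + 1) * h + h = \<theta> + 2 * real (Suc k) * h"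
      by (simp_all add: algebra_simps)
    have "?w (Suc k) \<in> ?P"
    proof (cases "Suc k = n")
      case True
      have "?w 0 \<in> ?P" using n by (intro w) simp
      then show ?thesis unfolding True wn .
    next
      case False
      with that have "Suc k < n" by simp
      then show ?thesis by (rule w)
    qed
    then show ?thesis
      unfolding sector_triangle_def 1 2
      using zero w[OF that] by (intro hull_minimal) auto
  qed
  then show "(\<Union>k<n. ?T k) \<subseteq> ?P" by blast
qed

lemma measure_hull_equally_spaced:
  assumes n: "n > 2" and r: "r > 0"
  defines "h \<equiv> pi / real n"
  shows "measure lebesgue (convex hull ((\<lambda>k. r *\<^sub>R circ (\<theta> + 2 * real k * h)) ` {..<n}))
    = real n * r\<^sup>2 * sin h * cos h"
proof -
  have h: "0 < h" "h < pi / 2" and nh: "real n * h = pi"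
    using n by (auto simp: h_def field_simps)
  let ?T = "\<lambda>k. sector_triangle r h (\<theta> + (2 * real k + 1) * h)"
  have "negligible (?T j \<inter> ?T k)" if "j < n" "k < n" "j \<noteq> k" for j k
  proof (rule negligible_sector_triangle_Int[OF h r])
    \<comment> \<open>Bisectors differ by \<open>2 * h * \<bar>d\<bar>\<close> with
      \<open>\<bar>d\<bar>\<close> between 1 and \<open>n - 1\<close>; since
      \<open>n * h = pi\<close>, this is the separation required above.\<close>
    define d where "d = int j - int k"
    have "1 \<le> \<bar>d\<bar>" "\<bar>d\<bar> \<le> int n - 1"
      using that unfolding d_def by linarith+
    then have "1 \<le> \<bar>real_of_int d\<bar>" "\<bar>real_of_int d\<bar> \<le> real n - 1"
      by linarith+
    then have "1 * h \<le> \<bar>real_of_int d\<bar> * h" "\<bar>real_of_int d\<bar> * h \<le> (real n - 1) * h"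
      using h by (intro mult_right_mono; simp)+
    moreover have "\<bar>(\<theta> + (2 * real j + 1) * h) - (\<theta> + (2 * real k + 1) * h)\<bar>
        = 2 * (\<bar>real_of_int d\<bar> * h)"
    proof -
      have "(\<theta> + (2 * real j + 1) * h) - (\<theta> + (2 * real k + 1) * h) = 2 * (real_of_int d * h)"
        by (simp add: d_def algebra_simps)
      then show ?thesis using h by (simp add: abs_mult)
    qed
    ultimately show "2 * h \<le> \<bar>(\<theta> + (2 * real j + 1) * h) - (\<theta> + (2 * real k + 1) * h)\<bar>"
      and "\<bar>(\<theta> + (2 * real j + 1) * h) - (\<theta> + (2 * real k + 1) * h)\<bar> \<le> 2 * pi - 2 * h"
      using nh by (simp_all add: left_diff_distrib)
  qed
  then have "pairwise (\<lambda>j k. negligible (?T j \<inter> ?T k)) {..<n}"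
    by (simp add: pairwise_def)
  then have "measure lebesgue (\<Union>k<n. ?T k) = (\<Sum>k<n. measure lebesgue (?T k))"
    by (intro measure_negligible_finite_Union_image) (auto simp: lmeasurable_sector_triangle)
  then show ?thesis
    using hull_eq_Union_sector_triangle[OF n r, of \<theta>]
    by (simp add: h_def[symmetric] measure_sector_triangle[OF h] mult.assoc)
qed

section \<open>Area in terms of the perimeter, and its growth\<close>

text \<open>With \<open>h = pi / n\<close>, the area is \<open>n * r^2 * sin h * cos h\<close> and
  the perimeter is \<open>2 * n * r * sin h\<close>; eliminating \<open>r\<close> gives the
  formula.\<close>

lemma regular_ngon_area:
  assumes reg: "regular_ngon n V"
  shows "convex_ngon_area n V = (ngon_perimeter n V)\<^sup>2 / (4 * real n * tan (pi / real n))"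
proof -
  define h where "h = pi / real n"
  obtain c r \<theta> where n: "n > 2" and r: "r > 0"
    and "\<forall>k<n. V k = c + r *\<^sub>R vector [cos (\<theta> + 2 * pi * real k / real n),
                                  sin (\<theta> + 2 * pi * real k / real n)]"
    using reg unfolding regular_ngon_def by blast
  then have V: "V k = c + r *\<^sub>R circ (\<theta> + 2 * real k * h)" if "k < n" for k
    using that by (simp add: circ_def h_def mult_ac)
  have h: "0 < h" "h < pi / 2"
    using n by (auto simp: h_def field_simps)
  have pos: "0 < sin h" "0 < cos h"
    using h by (auto intro!: sin_gt_zero cos_gt_zero)
  let ?w = "\<lambda>k. r *\<^sub>R circ (\<theta> + 2 * real k * h)"
  \<comment> \<open>Translation moves the centre to 0 without changing the measure.\<close>
  have "V ` {..<n} = (+) c ` ?w ` {..<n}"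
    unfolding image_image using V by (intro image_cong) auto
  then have area: "convex_ngon_area n V = real n * r\<^sup>2 * sin h * cos h"
    unfolding convex_ngon_area_def
    using measure_hull_equally_spaced[OF n r, of \<theta>]
    by (simp only: convex_hull_translation measure_translation h_def)
  have "dist (V 0) (V (Suc 0 mod n)) = 2 * r * sin h"
  proof -
    have "dist (V 0) (V (Suc 0 mod n)) = dist (V 0) (V 1)" using n by simp
    also have "\<dots> = 2 * r * \<bar>sin ((\<theta> + 2 * real 1 * h - (\<theta> + 2 * real 0 * h)) / 2)\<bar>"
      using V[of 0] V[of 1] n r
      by (simp only: circ_def dist_circle_points[OF less_imp_le])
    finally show ?thesis using pos by simp
  qed
  then have p: "ngon_perimeter n V = 2 * real n * r * sin h"
    using regular_ngon_side[OF reg, of 0] n by (simp add: field_simps)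
  show ?thesis
    unfolding area p h_def[symmetric] tan_def
    using pos n by (simp add: power2_eq_square field_simps)
qed

lemma x_over_tan_strict_decreasing:
  fixes x y :: real
  assumes "0 < x" "x < y" "y < pi / 2"
  shows "y / tan y < x / tan x"
proof -
  \<comment> \<open>In this form the quotient rule gives the numerator
    \<open>sin t * cos t - t\<close> after \<open>sin^2 + cos^2 = 1\<close>.\<close>
  have "y * cos y / sin y < x * cos x / sin x"
  proof (rule DERIV_neg_imp_decreasing[OF \<open>x < y\<close>])
    fix t assume t: "x \<le> t" "t \<le> y"
    have s: "0 < sin t" using assms t by (intro sin_gt_zero) auto
    have "cos t < 1"
      using assms t cos_monotone_0_pi[of 0 t] by auto
    then have "sin t * cos t < sin t" using s by simp
    also have "\<dots> \<le> t" using assms t by (intro sin_x_le_x) auto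
    finally have neg: "sin t * cos t - t < 0" by simp
    have "((\<lambda>t. t * cos t / sin t) has_real_derivative
        ((1 * cos t + - sin t * t) * sin t - t * cos t * cos t) / (sin t * sin t)) (at t)"
      using s by (auto intro!: derivative_eq_intros)
    moreover have "(1 * cos t + - sin t * t) * sin t - t * cos t * cos t = sin t * cos t - t"
      using sin_cos_squared_add3[of t] by algebra
    ultimately show "\<exists>d. ((\<lambda>t. t * cos t / sin t) has_real_derivative d) (at t) \<and> d < 0"
      using neg s by (metis divide_neg_pos mult_pos_pos)
  qed
  then show ?thesis by (simp add: tan_def)
qed

theorem mainTheorem2:
  fixes p :: real and V :: "nat \<Rightarrow> nat \<Rightarrow> real ^ 2" and A :: "nat \<Rightarrow> real"
  assumes "p > 0"
    and "\<And>n. n > 2 \<Longrightarrow> regular_ngon n (V n)"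
    and "\<And>n. n > 2 \<Longrightarrow> ngon_perimeter n (V n) = p"
    and "\<And>n. n > 2 \<Longrightarrow> A n = convex_ngon_area n (V n)"
  shows "(\<forall>n>2. A n = p\<^sup>2 / (4 * real n * tan (pi / real n))) \<and> (\<forall>n>2. A (n + 1) > A n)"
proof
  show area: "\<forall>n>2. A n = p\<^sup>2 / (4 * real n * tan (pi / real n))"
    using assms by (simp add: regular_ngon_area)
  have A: "A n = p\<^sup>2 / (4 * pi) * (pi / real n / tan (pi / real n))" if "n > 2" for n
    using area that by simp
  show "\<forall>n>2. A (n + 1) > A n"
  proof (intro allI impI)
    fix n :: nat assume n: "n > 2"
    \<comment> \<open>Here \<open>pi / (n + 1) < pi / n < pi / 2\<close>, the last bound because
      \<open>n > 2\<close>.\<close>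
    have "pi / real n / tan (pi / real n) < pi / real (n + 1) / tan (pi / real (n + 1))"
      using n by (intro x_over_tan_strict_decreasing) (auto simp: field_simps)
    then have "p\<^sup>2 / (4 * pi) * (pi / real n / tan (pi / real n))
        < p\<^sup>2 / (4 * pi) * (pi / real (n + 1) / tan (pi / real (n + 1)))"
      using \<open>p > 0\<close> by (intro mult_strict_left_mono) auto
    then show "A (n + 1) > A n"
      using A[OF n] A[of "n + 1"] n by (simp only:)
  qed
qed

end
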